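(* Let $n\ge 1$, let $f:\{-1,1\}^n\to\mathbb{R}$ be a non-constant function with minimum value $f^*$ and set of minimizers $\mathcal{X}^*$, let $\mathcal{G}(f)$ be its optimal gap, and let $p_\theta$ be a probability distribution on $\{-1,1\}^n$. For any $0<\delta<1$, if $$\mathbb{E}_{x\sim p_\theta}[f(x)]-f^*<(1-\delta)\,\mathcal{G}(f),$$ then $$\mathbb{P}_{x\sim p_\theta}(x\in\mathcal{X}^* )>\delta .$$ Therefore, for $x^1,\dots,x^m$ independently sampled from $p_\theta$, one has $\min_{1\le k\le m} f(x^k)=f^*$ with probability at least $1-(1-\delta)^m$.
   Context: $\mathcal{B}_n=\{-1,1\}^n$. For $f:\mathcal{B}_n\to\mathbb{R}$, $f^*=\min_{x\in\mathcal{B}_n}f(x)$ and $\mathcal{X}^*=\{x\in\mathcal{B}_n: f(x)=f^*\}$. The optimal gap of $f$ is $$\mathcal{G}(f)=\min_{x\in\mathcal{B}_n\setminus\mathcal{X}^*}f(x)-f^*.$$ *)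

theory Defs
  imports "HOL-Probability.Probability"
begin

text \<open>
  Points of \<open>{-1,1}\<^sup>n\<close> are extensional functions, i.e. they are
  \<open>undefined\<close> outside the index set \<open>{..<n}\<close>, so that the cube has exactly \<open>2 ^ n\<close>
  elements. A function on the cube is a HOL function whose values elsewhere are irrelevant.
\<close>

definition sign_cube :: "nat \<Rightarrow> (nat \<Rightarrow> real) set" where
  "sign_cube n = {..<n} \<rightarrow>\<^sub>E {-1, 1}"

definition min_value :: "nat \<Rightarrow> ((nat \<Rightarrow> real) \<Rightarrow> real) \<Rightarrow> real" where
  "min_value n f = Min (f ` sign_cube n)"

definition minimizers :: "nat \<Rightarrow> ((nat \<Rightarrow> real) \<Rightarrow> real) \<Rightarrow> (nat \<Rightarrow> real) set" where
  "minimizers n f = {x \<in> sign_cube n. f x = min_value n f}"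

text \<open>Meaningful only if \<open>f\<close> is non-constant on the cube; otherwise the first minimum ranges
  over the empty set.\<close>

definition optimal_gap :: "nat \<Rightarrow> ((nat \<Rightarrow> real) \<Rightarrow> real) \<Rightarrow> real" where
  "optimal_gap n f = Min (f ` (sign_cube n - minimizers n f)) - min_value n f"

end

theory Submission
  imports Defs
begin

text \<open>
  On the cube, \<open>f - f\<^sup>*\<close> dominates \<open>\<G>(f)\<close> times the indicator of the non-minimizers.
  Taking expectations as in Markov's inequality gives
  \<open>\<G>(f) * P(x \<notin> X\<^sup>*) \<le> E f - f\<^sup>* < (1 - \<delta>) * \<G>(f)\<close>, and \<open>\<G>(f) > 0\<close> cancels.
  By independence, all \<open>m\<close> samples miss \<open>X\<^sup>*\<close> with probability less than \<open>(1 - \<delta>)\<^sup>m\<close>.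
\<close>

lemma finite_sign_cube: "finite (sign_cube n)"
  unfolding sign_cube_def by (intro finite_PiE) auto

lemma min_value_le: "x \<in> sign_cube n \<Longrightarrow> min_value n f \<le> f x"
  unfolding min_value_def using finite_sign_cube by simp

lemma nonminimizers_nonempty:
  assumes "\<not> f constant_on sign_cube n"
  shows "sign_cube n - minimizers n f \<noteq> {}"
  using assms unfolding constant_on_def minimizers_def by blast

text \<open>Non-constancy makes the set of non-minimizers nonempty, and the cube is finite, so the
  minimum in the gap is attained at some non-minimizer, where \<open>f\<close> strictly exceeds its
  least value.\<close>

lemma optimal_gap_pos:
  assumes "\<not> f constant_on sign_cube n"
  shows "0 < optimal_gap n f"
proof -
  have "Min (f ` (sign_cube n - minimizers n f)) \<in> f ` (sign_cube n - minimizers n f)"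
    using nonminimizers_nonempty[OF assms] finite_sign_cube by (intro Min_in) auto
  then obtain x where x: "x \<in> sign_cube n - minimizers n f"
      "Min (f ` (sign_cube n - minimizers n f)) = f x"
    by blast
  then have "min_value n f < f x"
    using min_value_le[of x n f] by (auto simp: minimizers_def)
  with x show ?thesis
    by (simp add: optimal_gap_def)
qed

lemma optimal_gap_le:
  assumes "x \<in> sign_cube n" "x \<notin> minimizers n f"
  shows "optimal_gap n f \<le> f x - min_value n f"
  unfolding optimal_gap_def using assms finite_sign_cube by simp

lemma optimal_gap_mult_prob_le:
  assumes "set_pmf p \<subseteq> sign_cube n"
  shows "optimal_gap n f * measure_pmf.prob p (- minimizers n f)
    \<le> measure_pmf.expectation p f - min_value n f"
proof -
  have fin: "finite (set_pmf p)"
    using assms finite_sign_cube finite_subset by blast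
  have "optimal_gap n f * measure_pmf.prob p (- minimizers n f)
      = measure_pmf.expectation p (\<lambda>x. optimal_gap n f * indicator (- minimizers n f) x)"
    by simp
  also have "\<dots> \<le> measure_pmf.expectation p (\<lambda>x. f x - min_value n f)"
  proof (rule integral_mono_AE)
    \<comment> \<open>The bound may fail off the cube, where \<open>f\<close> is arbitrary. It is
      needed only on the support of \<open>p\<close>, which lies in the cube.\<close>
    show "AE x in measure_pmf p.
        optimal_gap n f * indicator (- minimizers n f) x \<le> f x - min_value n f"
      using assms optimal_gap_le min_value_le
      by (auto simp: AE_measure_pmf_iff indicator_def subset_iff)
  qed (auto intro: integrable_measure_pmf_finite fin)
  also have "\<dots> = measure_pmf.expectation p f - min_value n f"
    using fin by (simp add: integrable_measure_pmf_finite)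
  finally show ?thesis .
qed

lemma prob_minimizers_gt:
  assumes "\<not> f constant_on sign_cube n" "set_pmf p \<subseteq> sign_cube n"
    and "measure_pmf.expectation p f - min_value n f < (1 - \<delta>) * optimal_gap n f"
  shows "\<delta> < measure_pmf.prob p (minimizers n f)"
proof -
  have "optimal_gap n f * measure_pmf.prob p (- minimizers n f) < optimal_gap n f * (1 - \<delta>)"
    using optimal_gap_mult_prob_le[OF assms(2), of f] assms(3) by (simp add: mult.commute)
  then have "measure_pmf.prob p (- minimizers n f) < 1 - \<delta>"
    using optimal_gap_pos[OF assms(1)] by simp
  then show ?thesis
    using measure_pmf.prob_compl[of "minimizers n f" p] by (simp add: Compl_eq_Diff_UNIV)
qed

text \<open>The sample \<open>x k\<close> attains the value; the others cannot go below it because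
  they lie in the cube.\<close>

lemma Min_image_eq_min_value:
  assumes "finite K" "k \<in> K" "x k \<in> minimizers n f" "\<And>i. i \<in> K \<Longrightarrow> x i \<in> sign_cube n"
  shows "Min ((\<lambda>i. f (x i)) ` K) = min_value n f"
proof (rule Min_eqI)
  show "min_value n f \<in> (\<lambda>i. f (x i)) ` K"
    using assms(2,3) by (force simp: minimizers_def)
qed (use assms min_value_le in auto)

text \<open>Independence turns the probability of an intersection of preimages into a product, and
  each factor depends only on the common law \<open>p\<close>.\<close>

lemma (in prob_space) prob_all_iid_samples_in:
  assumes indep: "indep_vars (\<lambda>_. count_space UNIV) X K"
    and K: "finite K" "K \<noteq> {}"
    and distr: "\<And>k. k \<in> K \<Longrightarrow> distr M (count_space UNIV) (X k) = measure_pmf p"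
  shows "prob {\<omega> \<in> space M. \<forall>k\<in>K. X k \<omega> \<in> A} = measure_pmf.prob p A ^ card K"
proof -
  \<comment> \<open>Nonemptiness of \<open>K\<close> matters here: an empty intersection would be
    \<open>UNIV\<close> instead of \<open>space M\<close>.\<close>
  have "{\<omega> \<in> space M. \<forall>k\<in>K. X k \<omega> \<in> A} = (\<Inter>k\<in>K. X k -` A \<inter> space M)"
    using K by auto
  also have "prob \<dots> = (\<Prod>k\<in>K. prob (X k -` A \<inter> space M))"
    by (rule indep_varsD_finite[OF indep K(2,1)]) simp
  also have "\<dots> = (\<Prod>k\<in>K. measure_pmf.prob p A)"
  proof (rule prod.cong)
    fix k assume k: "k \<in> K"
    have "random_variable (count_space UNIV) (X k)"
      using indep k by (simp add: indep_vars_def)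
    then show "prob (X k -` A \<inter> space M) = measure_pmf.prob p A"
      using measure_distr[of "X k" M "count_space UNIV" A] distr[OF k] by simp
  qed simp
  finally show ?thesis
    by simp
qed

text \<open>Outside the event that every sample misses the minimizers, some sample hits one, and
  almost surely this makes the sample minimum optimal. The bound uses the exact hitting probability;
  \<delta> enters later by monotonicity.\<close>

lemma (in prob_space) prob_Min_samples_ge:
  assumes indep: "indep_vars (\<lambda>_. count_space UNIV) X K"
    and K: "finite K" "K \<noteq> {}"
    and distr: "\<And>k. k \<in> K \<Longrightarrow> distr M (count_space UNIV) (X k) = measure_pmf p"
    and p: "set_pmf p \<subseteq> sign_cube n"
  shows "1 - (1 - measure_pmf.prob p (minimizers n f)) ^ card K
    \<le> prob {\<omega> \<in> space M. Min ((\<lambda>k. f (X k \<omega>)) ` K) = min_value n f}"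
proof -
  have X [measurable]: "X k \<in> measurable M (count_space UNIV)" if "k \<in> K" for k
    using indep that by (simp add: indep_vars_def)
  have [measurable]: "(\<lambda>\<omega>. f (X k \<omega>)) \<in> borel_measurable M" if "k \<in> K" for k
    using measurable_comp[OF X[OF that], of f borel] by (simp add: comp_def)
  define miss where "miss = {\<omega> \<in> space M. \<forall>k\<in>K. X k \<omega> \<in> - minimizers n f}"
  have miss: "miss \<in> events"
    unfolding miss_def
  proof (rule sets.sets_Collect_finite_All[OF _ K(1)])
    fix k assume "k \<in> K"
    then show "{\<omega> \<in> space M. X k \<omega> \<in> - minimizers n f} \<in> events"
      using measurable_sets[OF X, of k "- minimizers n f"]
      by (simp add: vimage_def Int_def conj_commute)
  qed
  have "prob miss = (1 - measure_pmf.prob p (minimizers n f)) ^ card K"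
    unfolding miss_def
    using prob_all_iid_samples_in[OF indep K distr, of "- minimizers n f"]
      measure_pmf.prob_compl[of "minimizers n f" p] by (simp add: Compl_eq_Diff_UNIV)
  then have "1 - (1 - measure_pmf.prob p (minimizers n f)) ^ card K = prob (space M - miss)"
    using prob_compl[OF miss] by simp
  also have "\<dots> \<le> prob {\<omega> \<in> space M. Min ((\<lambda>k. f (X k \<omega>)) ` K) = min_value n f}"
  proof (rule finite_measure_mono_AE)
    \<comment> \<open>The law of \<open>X k\<close> is carried by the cube, but \<open>X k\<close>
      itself may leave it on a null set. Hence the two events are compared only almost
      everywhere.\<close>
    have "AE \<omega> in M. X k \<omega> \<in> sign_cube n" if "k \<in> K" for k
    proof -
      have "AE x in distr M (count_space UNIV) (X k). x \<in> sign_cube n"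
        unfolding distr[OF that] using p by (auto simp: AE_measure_pmf_iff)
      then show ?thesis
        using AE_distrD[OF X[OF that]] by blast
    qed
    then have "AE \<omega> in M. \<forall>k\<in>K. X k \<omega> \<in> sign_cube n"
      using K by (simp add: AE_finite_all)
    then show "AE \<omega> in M. \<omega> \<in> space M - miss \<longrightarrow>
        \<omega> \<in> {\<omega> \<in> space M. Min ((\<lambda>k. f (X k \<omega>)) ` K) = min_value n f}"
      by eventually_elim (auto simp: miss_def intro: Min_image_eq_min_value[OF K(1)])
    \<comment> \<open>Monotonicity of the measure requires the larger set to be an event, so the
      sample minimum has to be measurable.\<close>
    have "(\<lambda>\<omega>. Min ((\<lambda>k. f (X k \<omega>)) ` K)) \<in> borel_measurable M"
      using K by (intro borel_measurable_Min) auto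
    then show "{\<omega> \<in> space M. Min ((\<lambda>k. f (X k \<omega>)) ` K) = min_value n f} \<in> events"
      by measurable
  qed
  finally show ?thesis .
qed

theorem proposition2:
  fixes n :: nat
    and f :: "(nat \<Rightarrow> real) \<Rightarrow> real"
    and p :: "(nat \<Rightarrow> real) pmf"
    and \<delta> :: real
  assumes "n \<ge> 1"
    and "\<not> f constant_on sign_cube n"
    and "set_pmf p \<subseteq> sign_cube n"
    and "0 < \<delta>" and "\<delta> < 1"
    and "measure_pmf.expectation p f - min_value n f < (1 - \<delta>) * optimal_gap n f"
  shows "measure_pmf.prob p (minimizers n f) > \<delta> \<and>
    (\<forall>(M :: 'w measure) (X :: nat \<Rightarrow> 'w \<Rightarrow> (nat \<Rightarrow> real)) (m :: nat).
      m \<ge> 1 \<longrightarrow> prob_space M \<longrightarrow>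
      prob_space.indep_vars M (\<lambda>_. count_space UNIV) X {1..m} \<longrightarrow>
      (\<forall>k\<in>{1..m}. distr M (count_space UNIV) (X k) = measure_pmf p) \<longrightarrow>
      measure M {\<omega> \<in> space M. Min ((\<lambda>k. f (X k \<omega>)) ` {1..m}) = min_value n f}
        \<ge> 1 - (1 - \<delta>) ^ m)"
proof -
  have q: "\<delta> < measure_pmf.prob p (minimizers n f)"
    using prob_minimizers_gt assms by blast
  have "1 - (1 - \<delta>) ^ m
      \<le> measure M {\<omega> \<in> space M. Min ((\<lambda>k. f (X k \<omega>)) ` {1..m}) = min_value n f}"
    if "m \<ge> 1" "prob_space M" "prob_space.indep_vars M (\<lambda>_. count_space UNIV) X {1..m}"
      and distr: "\<forall>k\<in>{1..m}. distr M (count_space UNIV) (X k) = measure_pmf p"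
    for M :: "'w measure" and X :: "nat \<Rightarrow> 'w \<Rightarrow> (nat \<Rightarrow> real)" and m
  proof -
    \<comment> \<open>Powers are monotone here because the smaller base is nonnegative, a
      probability being at most 1.\<close>
    have "(1 - measure_pmf.prob p (minimizers n f)) ^ m \<le> (1 - \<delta>) ^ m"
      using q by (intro power_mono) auto
    moreover have "1 - (1 - measure_pmf.prob p (minimizers n f)) ^ card {1..m}
        \<le> measure M {\<omega> \<in> space M. Min ((\<lambda>k. f (X k \<omega>)) ` {1..m}) = min_value n f}"
      using that assms(3) by (intro prob_space.prob_Min_samples_ge) auto
    ultimately show ?thesis
      by simp
  qed
  with q show ?thesis
    by blast
qed

end
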